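(* Let $a,b$ be nonzero real numbers, let $(q_n)_{n\ge 0}$ be the bi-periodic Fibonacci sequence with parameters $a,b$, and let $O_n(a,b)=\sum_{s=0}^{7}q_{n+s}e_s$ ($n\ge 0$) be the bi-periodic Fibonacci octonions. Then $$\sum_{n=0}^{\infty}O_n(a,b)x^n=\frac{O_0(a,b)+x\,(O_1(a,b)-b\,O_0(a,b))+(a-b)R(x)}{1-bx-x^2},$$ where $$f(x)=\frac{x-x^3}{1-(ab+2)x^2+x^4}$$ and $$\begin{aligned}R(x)={}&\Big(xe_0+e_1+\tfrac1x e_2+\tfrac1{x^2}e_3+\tfrac1{x^3}e_4+\tfrac1{x^4}e_5+\tfrac1{x^5}e_6+\tfrac1{x^6}e_7\Big)f(x)\\ &-\Big(xe_1+e_2+\big(\tfrac1x+(ab+1)x\big)e_3+\big(\tfrac1{x^2}+ab+1\big)e_4\\ &\quad+\big(\tfrac1{x^3}+(ab+1)\tfrac1x+(a^2b^2+3ab+1)x\big)e_5+\big(\tfrac1{x^4}+(ab+1)\tfrac1{x^2}+(a^2b^2+3ab+1)\big)e_6\\ &\quad+\big(\tfrac1{x^5}+(ab+1)\tfrac1{x^3}+(a^2b^2+3ab+1)\tfrac1x+(a^3b^3+5a^2b^2+6ab+1)x\big)e_7\Big).\end{aligned}$$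
   Context: The bi-periodic Fibonacci sequence with nonzero real parameters $a,b$ is defined by $q_0=0$, $q_1=1$ and, for $n\ge 2$, $q_n=aq_{n-1}+q_{n-2}$ if $n$ is even, $q_n=bq_{n-1}+q_{n-2}$ if $n$ is odd. $e_0=1,e_1,\dots,e_7$ is the standard basis of the real octonion algebra $\mathcal{O}$ (an 8-dimensional real vector space). Only the vector space structure is used here: the variable $x$ commutes with all $e_s$, and the identity is understood coordinatewise as an identity of formal Laurent series in $x$ (the fractions $f(x)$ and $1/(1-bx-x^2)$ being expanded as power series at $x=0$). *)

theory Defs
  imports "HOL-Analysis.Analysis" "HOL-Computational_Algebra.Formal_Laurent_Series"
begin

unbundle no fps_syntax

fun biperiodic_fib :: "real \<Rightarrow> real \<Rightarrow> nat \<Rightarrow> real" where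
  "biperiodic_fib a b 0 = 0"
| "biperiodic_fib a b (Suc 0) = 1"
| "biperiodic_fib a b (Suc (Suc n)) =
     (if even n then a else b) * biperiodic_fib a b (Suc n) + biperiodic_fib a b n"

text \<open>
  Only the vector space structure of the octonions is used, so no multiplication is introduced.
  The index type \<open>8\<close> has the elements \<open>0, \<dots>, 7\<close> (with \<open>8 = 0\<close>), so \<open>of_nat\<close> is injective on the
  indices \<open>s \<le> 7\<close>.
\<close>

type_synonym octonion = "real ^ 8"

definition octonion_basis :: "nat \<Rightarrow> octonion" where
  "octonion_basis s = axis (of_nat s) 1"

definition biperiodic_fib_octonion :: "real \<Rightarrow> real \<Rightarrow> nat \<Rightarrow> octonion" where
  "biperiodic_fib_octonion a b n =
     (\<Sum>s=0..7. biperiodic_fib a b (n + s) *\<^sub>R octonion_basis s)"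

text \<open>
  A formal Laurent series with octonion coefficients is given by its eight coordinate series;
  scalar Laurent series act on it by \<open>*s\<close>.
\<close>

type_synonym octonion_fls = "real fls ^ 8"

definition octonion_const :: "octonion \<Rightarrow> octonion_fls" where
  "octonion_const v = (\<chi> i. fls_const (v $ i))"

definition octonion_gen_series :: "(nat \<Rightarrow> octonion) \<Rightarrow> octonion_fls" where
  "octonion_gen_series c = (\<chi> i. fps_to_fls (Abs_fps (\<lambda>n. c n $ i)))"

text \<open>
  Division is that of the field of formal Laurent series; since the denominator has constant
  term 1, the quotient is the power series expansion at 0.
\<close>

definition odd_part_series :: "real \<Rightarrow> real \<Rightarrow> real fls" where
  "odd_part_series a b =
     (let x = fls_X in (x - x ^ 3) / (1 - fls_const (a * b + 2) * x ^ 2 + x ^ 4))"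

definition remainder_series :: "real \<Rightarrow> real \<Rightarrow> octonion_fls" where
  "remainder_series a b =
     (let x = fls_X;
          f = odd_part_series a b;
          e = (\<lambda>s. octonion_const (octonion_basis s));
          q3 = fls_const (a * b + 1);
          q5 = fls_const (a ^ 2 * b ^ 2 + 3 * a * b + 1);
          q7 = fls_const (a ^ 3 * b ^ 3 + 5 * a ^ 2 * b ^ 2 + 6 * a * b + 1)
      in f *s (x *s e 0 + e 1 + (1 / x) *s e 2 + (1 / x ^ 2) *s e 3 + (1 / x ^ 3) *s e 4
               + (1 / x ^ 4) *s e 5 + (1 / x ^ 5) *s e 6 + (1 / x ^ 6) *s e 7)
         - (x *s e 1 + e 2
            + (1 / x + q3 * x) *s e 3
            + (1 / x ^ 2 + q3) *s e 4
            + (1 / x ^ 3 + q3 * (1 / x) + q5 * x) *s e 5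
            + (1 / x ^ 4 + q3 * (1 / x ^ 2) + q5) *s e 6
            + (1 / x ^ 5 + q3 * (1 / x ^ 3) + q5 * (1 / x) + q7 * x) *s e 7))"

end

theory Submission
  imports Defs
begin

text \<open>
  Write \<open>q\<close> for \<open>biperiodic_fib a b\<close>. The coordinate of index \<open>s\<close> of the generating series is the
  series \<open>G\<^sub>s\<close> with coefficients \<open>q (n + s)\<close>. Multiplying it by \<open>1 - b x - x\<^sup>2\<close> kills the coefficients
  in degrees \<open>n \<ge> 2\<close>, except where the recurrence uses \<open>a\<close> in place of \<open>b\<close>, which happens for
  \<open>n + s\<close> even. There the coefficient \<open>(a - b) q (n + s - 1)\<close> is left over; its index
  \<open>k = n + s - 1\<close> runs through the odd numbers \<open>k > s\<close>. So the remainder is \<open>(a - b) x\<^bsup>1 - s\<^esup>\<close>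
  times the part of \<open>\<Sum>\<^bsub>k odd\<^esub> q k x\<^sup>k\<close> in degrees above \<open>s\<close> (\<open>shifted_series_recurrence\<close>).

  Two identifications turn this into the closed formula. Terms of \<open>q\<close> two apart obey the
  constant-coefficient recurrence \<open>q (n + 4) = (a b + 2) q (n + 2) - q n\<close>, so the sum over odd indices
  is the rational series \<open>f\<close> (\<open>odd_part_series_eq\<close>). The terms of odd degree at most \<open>s \<le> 7\<close> that are
  subtracted from \<open>f\<close> have coefficients \<open>q 1\<close>, \<open>q 3\<close>, \<open>q 5\<close>, \<open>q 7\<close>, which are the polynomials in \<open>a b\<close>
  that occur in \<open>R\<close> (\<open>remainder_series_coordinate\<close>).
\<close>

section \<open>The part of odd index\<close>

text \<open>
  In two steps of the recurrence each of \<open>a\<close> and \<open>b\<close> is used once, so the two-step matrix has trace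
  \<open>a b + 2\<close> and determinant \<open>1\<close> whatever the parity of \<open>n\<close>.
\<close>

lemma biperiodic_fib_add_4:
  "biperiodic_fib a b (Suc (Suc (Suc (Suc n)))) =
     (a * b + 2) * biperiodic_fib a b (Suc (Suc n)) - biperiodic_fib a b n"
  by (cases "even n") (simp_all add: algebra_simps)

text \<open>Both denominators of the formula have this shape, which justifies clearing them.\<close>

lemma fls_one_plus_X_multiple_nonzero: "1 + fls_X * fps_to_fls g \<noteq> (0 :: real fls)"
proof -
  have "fls_nth (1 + fls_X * fps_to_fls g) 0 = (1 :: real)"
    by (simp add: fls_X_times_conv_shift)
  thus ?thesis by force
qed

text \<open>
  By \<open>biperiodic_fib_add_4\<close> the product of the series with the denominator of \<open>f\<close> vanishes from
  degree 4 on; the numerator \<open>x - x\<^sup>3\<close> records the initial values \<open>q 1 = 1\<close> and \<open>q 3 - (a b + 2) q 1 = -1\<close>.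
\<close>

lemma odd_part_series_eq:
  "odd_part_series a b = fps_to_fls (Abs_fps (\<lambda>n. if odd n then biperiodic_fib a b n else 0))"
    (is "_ = fps_to_fls ?F")
proof -
  let ?d = "1 - fps_const (a * b + 2) * fps_X ^ 2 + fps_X ^ 4 :: real fps"
  have expand: "?d * ?F = ?F - fps_const (a * b + 2) * (fps_X ^ 2 * ?F) + fps_X ^ 4 * ?F"
    by (simp only: distrib_right left_diff_distrib mult_1_left mult.assoc)
  have "fps_nth (?d * ?F) n = fps_nth (fps_X - fps_X ^ 3) n" for n
  proof -
    consider "n = 0" | "n = 1" | "n = 2" | "n = 3" | m where "n = Suc (Suc (Suc (Suc m)))"
      by (metis One_nat_def not0_implies_Suc numeral_2_eq_2 numeral_3_eq_3)
    hence "fps_nth (?F - fps_const (a * b + 2) * (fps_X ^ 2 * ?F) + fps_X ^ 4 * ?F) n =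
        fps_nth (fps_X - fps_X ^ 3) n"
    proof cases
      case 4
      have "biperiodic_fib a b 3 = a * b + 1"
        by (simp add: numeral_3_eq_3)
      with 4 show ?thesis by (simp add: fps_X_power_mult_nth fps_X_nth fps_X_power_nth)
    next
      case (5 m)
      have "n - 2 = Suc (Suc m)" "n - 4 = m" "\<not> n < 4" "\<not> n < 2"
        and "n \<noteq> 1" "n \<noteq> 3" "even n \<longleftrightarrow> even m"
        using 5 by auto
      thus ?thesis
        using biperiodic_fib_add_4[of a b m] unfolding 5[symmetric]
        by (simp add: fps_X_power_mult_nth fps_X_nth fps_X_power_nth del: biperiodic_fib.simps)
    qed (simp_all add: fps_X_power_mult_nth fps_X_nth fps_X_power_nth)
    thus ?thesis unfolding expand .
  qed
  hence "?d * ?F = fps_X - fps_X ^ 3" by (rule fps_ext)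
  hence "fps_to_fls (?d * ?F) = fps_to_fls (fps_X - fps_X ^ 3)" by simp
  hence "(1 - fls_const (a * b + 2) * fls_X ^ 2 + fls_X ^ 4) * fps_to_fls ?F = fls_X - fls_X ^ 3"
    by (simp add: fls_times_fps_to_fls fps_to_fls_power fls_plus_const)
  moreover have "1 - fls_const (a * b + 2) * fls_X ^ 2 + fls_X ^ 4 \<noteq> (0 :: real fls)"
    using fls_one_plus_X_multiple_nonzero[of "fps_X ^ 3 - fps_const (a * b + 2) * fps_X"]
    by (simp add: fls_times_fps_to_fls fps_to_fls_power algebra_simps power2_eq_square
        power3_eq_cube power4_eq_xxxx)
  ultimately show ?thesis
    by (simp add: odd_part_series_def Let_def field_simps)
qed

section \<open>The generating series of a shifted sequence\<close>

abbreviation shifted_series :: "real \<Rightarrow> real \<Rightarrow> nat \<Rightarrow> real fls" where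
  "shifted_series a b s \<equiv> fps_to_fls (Abs_fps (\<lambda>n. biperiodic_fib a b (n + s)))"

abbreviation odd_partial_sum :: "real \<Rightarrow> real \<Rightarrow> nat \<Rightarrow> real fls" where
  "odd_partial_sum a b s \<equiv>
     (\<Sum>k\<le>s. if odd k then fls_const (biperiodic_fib a b k) * fls_X ^ k else 0)"

lemma shifted_series_Suc:
  "shifted_series a b s = fls_const (biperiodic_fib a b s) + fls_X * shifted_series a b (Suc s)"
proof -
  have "Abs_fps (\<lambda>n. biperiodic_fib a b (n + s)) =
      fps_const (biperiodic_fib a b s) + fps_X * Abs_fps (\<lambda>n. biperiodic_fib a b (n + Suc s))"
    (is "?l = ?r")
    by (rule fps_ext) (simp split: nat.split)
  hence "fps_to_fls ?l = fps_to_fls ?r" by simp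
  thus ?thesis by (simp add: fls_times_fps_to_fls)
qed

lemma shifted_series_0_recurrence:
  "(1 - fls_const b * fls_X - fls_X ^ 2) * shifted_series a b 0 =
     fls_X + fls_const (a - b) * fls_X * odd_part_series a b"
proof -
  let ?G = "Abs_fps (\<lambda>n. biperiodic_fib a b n)"
  let ?F = "Abs_fps (\<lambda>n. if odd n then biperiodic_fib a b n else 0)"
  have "(1 - fps_const b * fps_X - fps_X ^ 2) * ?G = fps_X + fps_const (a - b) * fps_X * ?F"
    (is "?l = ?r")
  proof (rule fps_ext)
    fix n
    consider "n = 0" | "n = 1" | m where "n = Suc (Suc m)"
      by (metis One_nat_def not0_implies_Suc)
    thus "fps_nth ?l n = fps_nth ?r n"
      by cases (simp_all add: algebra_simps power2_eq_square)
  qed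
  hence "fps_to_fls ?l = fps_to_fls ?r" by simp
  thus ?thesis by (simp add: fls_times_fps_to_fls fps_to_fls_power odd_part_series_eq)
qed

text \<open>
  The induction on \<open>s\<close> compares \<open>G\<^sub>s = q s + x G\<^bsub>s + 1\<^esub>\<close> with the claimed right-hand sides. They
  match because the step of the recurrence leading to \<open>q (s + 2)\<close> deviates from the one with
  coefficient \<open>b\<close> by \<open>(a - b) q (s + 1)\<close> for even \<open>s\<close>, exactly when the partial sum of odd degrees
  gains the term \<open>q (s + 1) x\<^bsup>s + 1\<^esup>\<close>. The factor \<open>x\<^bsup>1 - s\<^esup>\<close> is written \<open>x / x\<^sup>s\<close> to stay with
  natural exponents.
\<close>

lemma shifted_series_recurrence:
  "(1 - fls_const b * fls_X - fls_X ^ 2) * shifted_series a b s =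
     fls_const (biperiodic_fib a b s)
     + fls_X * fls_const (biperiodic_fib a b (Suc s) - b * biperiodic_fib a b s)
     + fls_const (a - b) * (fls_X / fls_X ^ s * (odd_part_series a b - odd_partial_sum a b s))"
proof (induction s)
  case 0
  show ?case using shifted_series_0_recurrence[of b a]
    by (simp add: mult.assoc)
next
  case (Suc s)
  \<comment> \<open>Opaque names make the step an identity in an arbitrary field; simplification rules would
    otherwise turn quotients by powers of \<open>fls_X\<close> into shifts of series.\<close>
  define X :: "real fls" where "X = fls_X"
  have [simp]: "X \<noteq> 0" by (simp add: X_def)
  define \<beta> where "\<beta> = fls_const b"
  define \<delta> where "\<delta> = fls_const (a - b)"
  define c where "c = (if even s then \<delta> else 0)"
  define q where "q = (\<lambda>k. fls_const (biperiodic_fib a b k))"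
  define G where "G = shifted_series a b"
  define P where "P = (\<lambda>s. odd_part_series a b - odd_partial_sum a b s)"
  have diff: "fls_const (biperiodic_fib a b (Suc k) - b * biperiodic_fib a b k) =
      q (Suc k) - \<beta> * q k" for k
    by (simp add: q_def \<beta>_def flip: fls_minus_const)
  have G: "G s = q s + X * G (Suc s)"
    unfolding G_def q_def X_def by (rule shifted_series_Suc)
  have q: "q (Suc (Suc s)) = \<beta> * q (Suc s) + q s + c * q (Suc s)"
    by (simp add: q_def c_def \<beta>_def \<delta>_def fls_plus_const algebra_simps)
  have P: "\<delta> * P (Suc s) = \<delta> * P s - c * q (Suc s) * X ^ Suc s"
    by (simp add: P_def c_def q_def X_def algebra_simps)
  have IH: "(1 - \<beta> * X - X ^ 2) * G s =
      q s + X * (q (Suc s) - \<beta> * q s) + \<delta> * (X / X ^ s * P s)"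
    using Suc.IH unfolding diff by (simp only: \<beta>_def X_def G_def q_def \<delta>_def P_def)
  have "X * ((1 - \<beta> * X - X ^ 2) * G (Suc s)) =
      (1 - \<beta> * X - X ^ 2) * G s - (1 - \<beta> * X - X ^ 2) * q s"
    unfolding G by (simp add: algebra_simps)
  also have "\<dots> = X * (q (Suc s) + X * (q (Suc (Suc s)) - \<beta> * q (Suc s))
      + X / X ^ Suc s * (\<delta> * P (Suc s)))"
    unfolding IH q P by (simp add: field_simps power2_eq_square)
  finally have "(1 - \<beta> * X - X ^ 2) * G (Suc s) =
      q (Suc s) + X * (q (Suc (Suc s)) - \<beta> * q (Suc s)) + \<delta> * (X / X ^ Suc s * P (Suc s))"
    by (simp add: mult.left_commute)
  thus ?case unfolding diff by (simp only: \<beta>_def X_def G_def q_def \<delta>_def P_def)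
qed

section \<open>Coordinates\<close>

lemma octonion_index_cases:
  fixes i :: 8
  obtains s where "s < 8" "i = of_nat s"
proof (cases i rule: bit0_cases)
  case (of_int z)
  show ?thesis
    by (rule that[of "nat z"]) (use of_int in \<open>auto\<close>)
qed

lemma octonion_index_eq_iff:
  assumes "s < 8" "t < 8"
  shows "(of_nat s :: 8) = of_nat t \<longleftrightarrow> s = t"
proof -
  have "(of_nat m :: 8) \<noteq> of_nat n" if "m < n" "n < 8" for m n
    using that by (auto simp: of_nat_eq_iff_char_dvd dest: dvd_imp_le)
  thus ?thesis using assms by (metis linorder_neqE_nat)
qed

lemma biperiodic_fib_octonion_coordinate:
  assumes "s < 8"
  shows "vec_nth (biperiodic_fib_octonion a b n) (of_nat s) = biperiodic_fib a b (n + s)"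
proof -
  have "vec_nth (biperiodic_fib_octonion a b n) (of_nat s) =
      (\<Sum>t=0..7. if t = s then biperiodic_fib a b (n + t) else 0)"
    unfolding biperiodic_fib_octonion_def sum_component
    by (intro sum.cong refl)
       (use assms in \<open>auto simp: octonion_basis_def axis_def octonion_index_eq_iff\<close>)
  also have "\<dots> = biperiodic_fib a b (n + s)"
    using assms by simp
  finally show ?thesis .
qed

lemma octonion_const_basis_coordinate:
  assumes "s < 8" "t < 8"
  shows "vec_nth (octonion_const (octonion_basis t)) (of_nat s) = (if s = t then 1 else 0)"
  using octonion_index_eq_iff[OF assms]
  by (auto simp: octonion_const_def octonion_basis_def axis_def)

text \<open>
  All eight coordinates of \<open>R\<close> are instances of one expression: the factor \<open>x\<^bsup>1 - s\<^esup>\<close> of \<open>f\<close> in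
  coordinate \<open>s\<close> also multiplies the terms \<open>q k x\<^sup>k\<close> with odd \<open>k \<le> s\<close>, giving the subtracted
  \<open>q k x\<^bsup>k + 1 - s\<^esup>\<close>.
\<close>

lemma remainder_series_coordinate:
  assumes "s < 8"
  shows "vec_nth (remainder_series a b) (of_nat s) =
     fls_X / fls_X ^ s * (odd_part_series a b - odd_partial_sum a b s)"
proof -
  define X :: "real fls" where "X = fls_X"
  have [simp]: "X \<noteq> 0" by (simp add: X_def)
  have q3: "biperiodic_fib a b 3 = a * b + 1"
    and q5: "biperiodic_fib a b 5 = a ^ 2 * b ^ 2 + 3 * a * b + 1"
    and q7: "biperiodic_fib a b 7 = a ^ 3 * b ^ 3 + 5 * a ^ 2 * b ^ 2 + 6 * a * b + 1"
  proof -
    show q3: "biperiodic_fib a b 3 = a * b + 1"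
      by (simp add: numeral_3_eq_3)
    have "biperiodic_fib a b 5 = (a * b + 2) * biperiodic_fib a b 3 - biperiodic_fib a b (Suc 0)"
      using biperiodic_fib_add_4[of a b "Suc 0"]
      by (simp add: eval_nat_numeral del: biperiodic_fib.simps)
    thus q5: "biperiodic_fib a b 5 = a ^ 2 * b ^ 2 + 3 * a * b + 1"
      by (simp add: q3 algebra_simps power2_eq_square)
    have "biperiodic_fib a b 7 = (a * b + 2) * biperiodic_fib a b 5 - biperiodic_fib a b 3"
      using biperiodic_fib_add_4[of a b 3]
      by (simp add: eval_nat_numeral del: biperiodic_fib.simps)
    thus "biperiodic_fib a b 7 = a ^ 3 * b ^ 3 + 5 * a ^ 2 * b ^ 2 + 6 * a * b + 1"
      by (simp add: q3 q5 algebra_simps power2_eq_square power3_eq_cube)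
  qed
  define S where "S = odd_partial_sum a b"
  have up_to: "{..Suc 0} = {0, 1}" "{..2::nat} = {0, 1, 2}" "{..3::nat} = {0, 1, 2, 3}"
     "{..4::nat} = {0, 1, 2, 3, 4}" "{..5::nat} = {0, 1, 2, 3, 4, 5}"
     "{..6::nat} = {0, 1, 2, 3, 4, 5, 6}" "{..7::nat} = {0, 1, 2, 3, 4, 5, 6, 7}"
    by auto
  have T: "S 0 = 0"
     "S (Suc 0) = X"
     "S 2 = X"
     "S 3 = X + fls_const (biperiodic_fib a b 3) * X ^ 3"
     "S 4 = X + fls_const (biperiodic_fib a b 3) * X ^ 3"
     "S 5 = X + fls_const (biperiodic_fib a b 3) * X ^ 3
        + fls_const (biperiodic_fib a b 5) * X ^ 5"
     "S 6 = X + fls_const (biperiodic_fib a b 3) * X ^ 3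
        + fls_const (biperiodic_fib a b 5) * X ^ 5"
     "S 7 = X + fls_const (biperiodic_fib a b 3) * X ^ 3
        + fls_const (biperiodic_fib a b 5) * X ^ 5
        + fls_const (biperiodic_fib a b 7) * X ^ 7"
    by (simp_all add: S_def X_def up_to)
  have "s \<in> {0,1,2,3,4,5,6,7}" using assms by auto
  \<comment> \<open>The values of the partial sums must be inserted while their arguments are still numerals, hence
    two rounds of simplification.\<close>
  hence "vec_nth (remainder_series a b) (of_nat s) = X / X ^ s * (odd_part_series a b - S s)"
    unfolding remainder_series_def Let_def X_def[symmetric] using assms
    by (elim insertE emptyE;
        simp add: octonion_const_basis_coordinate T q3 q5 q7
          del: of_nat_numeral of_nat_0 of_nat_1 of_nat_Suc;
        simp add: field_simps eval_nat_numeral)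
  thus ?thesis by (simp only: X_def S_def)
qed

theorem theorem2p4:
  fixes a b :: real
  assumes "a \<noteq> 0" and "b \<noteq> 0"
  shows "octonion_gen_series (biperiodic_fib_octonion a b) =
    (1 / (1 - fls_const b * fls_X - fls_X ^ 2)) *s
      (octonion_const (biperiodic_fib_octonion a b 0)
       + fls_X *s octonion_const (biperiodic_fib_octonion a b 1
                                  - b *\<^sub>R biperiodic_fib_octonion a b 0)
       + fls_const (a - b) *s remainder_series a b)"
proof -
  define D :: "real fls" where "D = 1 - fls_const b * fls_X - fls_X ^ 2"
  define N where "N = octonion_const (biperiodic_fib_octonion a b 0)
       + fls_X *s octonion_const (biperiodic_fib_octonion a b 1
                                  - b *\<^sub>R biperiodic_fib_octonion a b 0)
       + fls_const (a - b) *s remainder_series a b"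
  have "D \<noteq> 0"
    using fls_one_plus_X_multiple_nonzero[of "- fps_const b - fps_X"]
    by (simp add: D_def algebra_simps power2_eq_square)
  have "octonion_gen_series (biperiodic_fib_octonion a b) = (1 / D) *s N"
  proof (subst vec_eq_iff, rule allI)
    fix i :: 8
    obtain s where s: "s < 8" and i: "i = of_nat s" by (rule octonion_index_cases)
    have N: "vec_nth N i = fls_const (biperiodic_fib a b s)
       + fls_X * fls_const (biperiodic_fib a b (Suc s) - b * biperiodic_fib a b s)
       + fls_const (a - b) * (fls_X / fls_X ^ s * (odd_part_series a b - odd_partial_sum a b s))"
      using s by (simp add: N_def i octonion_const_def biperiodic_fib_octonion_coordinate
          remainder_series_coordinate)
    have "vec_nth (octonion_gen_series (biperiodic_fib_octonion a b)) i = shifted_series a b s"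
      using s by (simp add: i octonion_gen_series_def biperiodic_fib_octonion_coordinate)
    also have "\<dots> = 1 / D * vec_nth N i"
      using \<open>D \<noteq> 0\<close> unfolding N shifted_series_recurrence[symmetric] D_def by simp
    finally show "vec_nth (octonion_gen_series (biperiodic_fib_octonion a b)) i =
        vec_nth ((1 / D) *s N) i"
      by simp
  qed
  thus ?thesis unfolding D_def N_def .
qed

end
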